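(* Consider the aggregated formulation $\mathrm{AGG}_\alpha$ and the disaggregated formulation $\mathrm{DIS}_\alpha$ of the optimal coalition structure problem, with linear programming relaxations $F_{\mathrm{agg}}$ and $F_{\mathrm{disagg}}$, compared in the common coordinates $(v,\phi,z,x,y,\pi)$ (together with $w$ when $\alpha<1$) via $\phi_{ig}:=v_{ig}$. Then the two formulations have the same mixed-integer feasible points. Their relaxations satisfy $F_{\mathrm{disagg}}\subseteq F_{\mathrm{agg}}$, and the inclusion can be strict (there are instances for which it is strict). Moreover, adding the linking constraints $v_i=\sum_{g\in G}\phi_{ig}$ ($i\in N$) to $F_{\mathrm{agg}}$ recovers $F_{\mathrm{disagg}}$ exactly.
   Context: $N=\{1,\dots,n\}$ is a finite player set, $G:=N$ indexes groups, $R$ is a finite item set, $I_j\subseteq N$ is the set of players for whom item $j$ is available, $R_i=\{j\in R:i\in I_j\}$. Data: profits $p^i_j\ge0$, weights $a_j>0$, budgets $b^i$, capacities $u^i_j\ge 0$, private constraints $B^ix^i\le d^i$ (satisfied by $x^i=0$), pooling parameter $\alpha\in(0,1]$. Set $M=\sum_{i\in N}\sum_{j\in R_i}p^i_ju^i_j$. **Common constraints** (for all $i\in N$, $g\in G$, $j\in R$): $\sum_{g\in G}z_{ig}=1$; $\pi_g=\sum_{j\in R}\sum_{i\in I_j}p^i_jx^{i,g}_j$; $\sum_{j\in R}a_jy^g_j\le\sum_{i\in N}b^iz_{ig}$; $y^g_j=\sum_{i\in I_j}x^{i,g}_j$; $B^ix^{i,g}\le d^iz_{ig}$; $0\le x^{i,g}_j\le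 u^i_jz_{ig}$ for $i\in I_j$; $y^g_j\le\sum_{i\in I_j}u^i_jz_{ig}$; $z_{ig}=0$ whenever $i<g$; $\sum_{i\in N}z_{ig}\le|N|z_{gg}$; $v_i\ge0$, $\pi_g\ge0$, $y^g_j\in\mathbb Z_+$, $z_{ig}\in\{0,1\}$; and, only if $\alpha<1$: $w^g_j\in\{0,1\}$, $2w^g_j\le\sum_{i\in I_j}z_{ig}\le(|I_j|-1)w^g_j+1$, $y^g_j\le\alpha\sum_{i\in I_j}u^i_jz_{ig}+M_j(1-w^g_j)$ with $M_j\ge(1-\alpha)\max_{i\in I_j}u^i_j$. **$\mathrm{AGG}_\alpha$**: the common constraints together with $\pi_g=\sum_{i\in N}\phi_{ig}$ and the McCormick constraints $\phi_{ig}\le v_i$, $\phi_{ig}\le Mz_{ig}$, $\phi_{ig}\ge v_i-M(1-z_{ig})$, $\phi_{ig}\ge0$ for all $i,g$. **$\mathrm{DIS}_\alpha$**: the common constraints together with per-group payoff variables $v_{ig}\ge0$ satisfying $v_i=\sum_{g\in G}v_{ig}$ for all $i$, $\pi_g=\sum_{i\in N}v_{ig}$ for all $g$, and $v_{ig}\le Mz_{ig}$ for all $i,g$. Both maximize $\sum_{i\in N}v_i$. $F_{\mathrm{agg}}$, $F_{\mathrm{disagg}}$ denote the feasible sets of the LP relaxations, obtained by replacing $y^g_j\in\mathbb Z_+$ by $y^g_j\ge0$ and binary variables by variables in $[0,1]$. *)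

theory Defs
  imports Complex_Main "HOL-Library.FuncSet"
begin

text \<open>
  Matrices are given entrywise: \<open>priv_mat I i k j\<close> is the entry of the matrix of player \<open>i\<close> in
  row \<open>k < priv_rows I i\<close> and column \<open>j\<close>, where \<open>j\<close> ranges over the items available to \<open>i\<close>.
\<close>

record 'r cs_instance =
  num_players :: nat
  items :: "'r set"
  avail :: "'r \<Rightarrow> nat set"              \<comment> \<open>\<open>I\<^sub>j\<close>\<close>
  profit :: "nat \<Rightarrow> 'r \<Rightarrow> real"         \<comment> \<open>\<open>p\<^sup>i\<^sub>j\<close>\<close>
  weight :: "'r \<Rightarrow> real"               \<comment> \<open>\<open>a\<^sub>j\<close>\<close>
  budget :: "nat \<Rightarrow> real"              \<comment> \<open>\<open>b\<^sup>i\<close>\<close>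
  capacity :: "nat \<Rightarrow> 'r \<Rightarrow> real"       \<comment> \<open>\<open>u\<^sup>i\<^sub>j\<close>\<close>
  priv_rows :: "nat \<Rightarrow> nat"
  priv_mat :: "nat \<Rightarrow> nat \<Rightarrow> 'r \<Rightarrow> real" \<comment> \<open>\<open>B\<^sup>i\<close>\<close>
  priv_rhs :: "nat \<Rightarrow> nat \<Rightarrow> real"      \<comment> \<open>\<open>d\<^sup>i\<close>\<close>
  pooling :: real                      \<comment> \<open>\<open>\<alpha>\<close>\<close>
  bigM_item :: "'r \<Rightarrow> real"            \<comment> \<open>\<open>M\<^sub>j\<close>, used only if \<open>\<alpha> < 1\<close>\<close>

definition players :: "'r cs_instance \<Rightarrow> nat set" where
  "players I = {1..num_players I}"

abbreviation groups :: "'r cs_instance \<Rightarrow> nat set" where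
  "groups I \<equiv> players I"

definition items_of :: "'r cs_instance \<Rightarrow> nat \<Rightarrow> 'r set" where
  "items_of I i = {j \<in> items I. i \<in> avail I j}"

text \<open>
  The inequality \<open>0 \<le> priv_rhs I i k\<close> says that the zero vector satisfies the private constraints.
  The maximum defining the bound on \<open>M\<^sub>j\<close> only makes sense for an item available to some player.
\<close>

definition valid_instance :: "'r cs_instance \<Rightarrow> bool" where
  "valid_instance I \<longleftrightarrow>
     finite (items I) \<and>
     (\<forall>j\<in>items I. avail I j \<subseteq> players I) \<and>
     (\<forall>j\<in>items I. \<forall>i\<in>avail I j. 0 \<le> profit I i j \<and> 0 \<le> capacity I i j) \<and>
     (\<forall>j\<in>items I. 0 < weight I j) \<and>
     (\<forall>i\<in>players I. \<forall>k<priv_rows I i. 0 \<le> priv_rhs I i k) \<and>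
     0 < pooling I \<and> pooling I \<le> 1 \<and>
     (pooling I < 1 \<longrightarrow>
       (\<forall>j\<in>items I. avail I j \<noteq> {} \<longrightarrow>
          (1 - pooling I) * Max ((\<lambda>i. capacity I i j) ` avail I j) \<le> bigM_item I j))"

definition bigM :: "'r cs_instance \<Rightarrow> real" where
  "bigM I = (\<Sum>i\<in>players I. \<Sum>j\<in>items_of I i. profit I i j * capacity I i j)"

record 'r cs_vars =
  payoff :: "nat \<Rightarrow> real"                \<comment> \<open>\<open>v\<^sub>i\<close>\<close>
  member :: "nat \<times> nat \<Rightarrow> real"          \<comment> \<open>\<open>z\<close> at \<open>(i, g)\<close>\<close>
  alloc :: "nat \<times> nat \<times> 'r \<Rightarrow> real"      \<comment> \<open>\<open>x\<close> at \<open>(i, g, j)\<close>\<close>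
  quantity :: "nat \<times> 'r \<Rightarrow> real"         \<comment> \<open>\<open>y\<close> at \<open>(g, j)\<close>\<close>
  gprofit :: "nat \<Rightarrow> real"               \<comment> \<open>\<open>\<pi>\<^sub>g\<close>\<close>
  pooled :: "nat \<times> 'r \<Rightarrow> real"           \<comment> \<open>\<open>w\<close> at \<open>(g, j)\<close>\<close>

text \<open>
  Coordinates outside the index sets are pinned to \<^const>\<open>undefined\<close>, so that equality of points
  is equality of the actual coordinates; in particular \<open>w\<close> is no coordinate if \<open>\<alpha> = 1\<close>.
\<close>

definition coordinates ::
    "'r cs_instance \<Rightarrow> 'r cs_vars \<Rightarrow> (nat \<times> nat \<Rightarrow> real) \<Rightarrow> bool" where
  "coordinates I c \<phi> \<longleftrightarrow>
     payoff c \<in> extensional (players I) \<and>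
     member c \<in> extensional (players I \<times> groups I) \<and>
     alloc c \<in> extensional {(i, g, j). g \<in> groups I \<and> j \<in> items I \<and> i \<in> avail I j} \<and>
     quantity c \<in> extensional (groups I \<times> items I) \<and>
     gprofit c \<in> extensional (groups I) \<and>
     pooled c \<in> extensional (if pooling I < 1 then groups I \<times> items I else {}) \<and>
     \<phi> \<in> extensional (players I \<times> groups I)"

definition pooling_constraints :: "'r cs_instance \<Rightarrow> 'r cs_vars \<Rightarrow> bool" where
  "pooling_constraints I c \<longleftrightarrow>
     (\<forall>g\<in>groups I. \<forall>j\<in>items I.
        2 * pooled c (g, j) \<le> (\<Sum>i\<in>avail I j. member c (i, g)) \<and>
        (\<Sum>i\<in>avail I j. member c (i, g)) \<le> (real (card (avail I j)) - 1) * pooled c (g, j) + 1 \<and>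
        quantity c (g, j) \<le> pooling I * (\<Sum>i\<in>avail I j. capacity I i j * member c (i, g))
          + bigM_item I j * (1 - pooled c (g, j)))"

text \<open>The common constraints except for the domains of \<open>y\<close>, \<open>z\<close> and \<open>w\<close>.\<close>

definition common_constraints :: "'r cs_instance \<Rightarrow> 'r cs_vars \<Rightarrow> bool" where
  "common_constraints I c \<longleftrightarrow>
     (\<forall>i\<in>players I. (\<Sum>g\<in>groups I. member c (i, g)) = 1) \<and>
     (\<forall>g\<in>groups I. gprofit c g =
        (\<Sum>j\<in>items I. \<Sum>i\<in>avail I j. profit I i j * alloc c (i, g, j))) \<and>
     (\<forall>g\<in>groups I. (\<Sum>j\<in>items I. weight I j * quantity c (g, j))
        \<le> (\<Sum>i\<in>players I. budget I i * member c (i, g))) \<and>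
     (\<forall>g\<in>groups I. \<forall>j\<in>items I. quantity c (g, j) = (\<Sum>i\<in>avail I j. alloc c (i, g, j))) \<and>
     (\<forall>i\<in>players I. \<forall>g\<in>groups I. \<forall>k<priv_rows I i.
        (\<Sum>j\<in>items_of I i. priv_mat I i k j * alloc c (i, g, j))
          \<le> priv_rhs I i k * member c (i, g)) \<and>
     (\<forall>g\<in>groups I. \<forall>j\<in>items I. \<forall>i\<in>avail I j.
        0 \<le> alloc c (i, g, j) \<and> alloc c (i, g, j) \<le> capacity I i j * member c (i, g)) \<and>
     (\<forall>g\<in>groups I. \<forall>j\<in>items I.
        quantity c (g, j) \<le> (\<Sum>i\<in>avail I j. capacity I i j * member c (i, g))) \<and>
     (\<forall>i\<in>players I. \<forall>g\<in>groups I. i < g \<longrightarrow> member c (i, g) = 0) \<and>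
     (\<forall>g\<in>groups I. (\<Sum>i\<in>players I. member c (i, g))
        \<le> real (card (players I)) * member c (g, g)) \<and>
     (\<forall>i\<in>players I. 0 \<le> payoff c i) \<and>
     (\<forall>g\<in>groups I. 0 \<le> gprofit c g) \<and>
     (pooling I < 1 \<longrightarrow> pooling_constraints I c)"

definition integral_domain :: "'r cs_instance \<Rightarrow> 'r cs_vars \<Rightarrow> bool" where
  "integral_domain I c \<longleftrightarrow>
     (\<forall>g\<in>groups I. \<forall>j\<in>items I. quantity c (g, j) \<in> \<nat>) \<and>
     (\<forall>i\<in>players I. \<forall>g\<in>groups I. member c (i, g) \<in> {0, 1}) \<and>
     (pooling I < 1 \<longrightarrow> (\<forall>g\<in>groups I. \<forall>j\<in>items I. pooled c (g, j) \<in> {0, 1}))"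

definition relaxed_domain :: "'r cs_instance \<Rightarrow> 'r cs_vars \<Rightarrow> bool" where
  "relaxed_domain I c \<longleftrightarrow>
     (\<forall>g\<in>groups I. \<forall>j\<in>items I. 0 \<le> quantity c (g, j)) \<and>
     (\<forall>i\<in>players I. \<forall>g\<in>groups I. member c (i, g) \<in> {0..1}) \<and>
     (pooling I < 1 \<longrightarrow> (\<forall>g\<in>groups I. \<forall>j\<in>items I. pooled c (g, j) \<in> {0..1}))"

definition agg_constraints ::
    "'r cs_instance \<Rightarrow> 'r cs_vars \<Rightarrow> (nat \<times> nat \<Rightarrow> real) \<Rightarrow> bool" where
  "agg_constraints I c \<phi> \<longleftrightarrow>
     (\<forall>g\<in>groups I. gprofit c g = (\<Sum>i\<in>players I. \<phi> (i, g))) \<and>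
     (\<forall>i\<in>players I. \<forall>g\<in>groups I.
        \<phi> (i, g) \<le> payoff c i \<and>
        \<phi> (i, g) \<le> bigM I * member c (i, g) \<and>
        payoff c i - bigM I * (1 - member c (i, g)) \<le> \<phi> (i, g) \<and>
        0 \<le> \<phi> (i, g))"

definition dis_constraints ::
    "'r cs_instance \<Rightarrow> 'r cs_vars \<Rightarrow> (nat \<times> nat \<Rightarrow> real) \<Rightarrow> bool" where
  "dis_constraints I c vg \<longleftrightarrow>
     (\<forall>i\<in>players I. payoff c i = (\<Sum>g\<in>groups I. vg (i, g))) \<and>
     (\<forall>g\<in>groups I. gprofit c g = (\<Sum>i\<in>players I. vg (i, g))) \<and>
     (\<forall>i\<in>players I. \<forall>g\<in>groups I.
        0 \<le> vg (i, g) \<and> vg (i, g) \<le> bigM I * member c (i, g))"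

text \<open>
  In all four sets the second component of a point is the array \<open>\<phi>\<close> of the common coordinates. For
  the disaggregated formulation it is the array of the payoffs \<open>v\<^sub>i\<^sub>g\<close>, which realises the
  identification of \<open>\<phi>\<^sub>i\<^sub>g\<close> with \<open>v\<^sub>i\<^sub>g\<close>.
\<close>

definition MIP_agg :: "'r cs_instance \<Rightarrow> ('r cs_vars \<times> (nat \<times> nat \<Rightarrow> real)) set" where
  "MIP_agg I = {(c, \<phi>). coordinates I c \<phi> \<and> common_constraints I c \<and> integral_domain I c \<and>
                        agg_constraints I c \<phi>}"

definition MIP_disagg :: "'r cs_instance \<Rightarrow> ('r cs_vars \<times> (nat \<times> nat \<Rightarrow> real)) set" where
  "MIP_disagg I = {(c, vg). coordinates I c vg \<and> common_constraints I c \<and> integral_domain I c \<and>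
                            dis_constraints I c vg}"

definition F_agg :: "'r cs_instance \<Rightarrow> ('r cs_vars \<times> (nat \<times> nat \<Rightarrow> real)) set" where
  "F_agg I = {(c, \<phi>). coordinates I c \<phi> \<and> common_constraints I c \<and> relaxed_domain I c \<and>
                      agg_constraints I c \<phi>}"

definition F_disagg :: "'r cs_instance \<Rightarrow> ('r cs_vars \<times> (nat \<times> nat \<Rightarrow> real)) set" where
  "F_disagg I = {(c, vg). coordinates I c vg \<and> common_constraints I c \<and> relaxed_domain I c \<and>
                          dis_constraints I c vg}"

definition linking :: "'r cs_instance \<Rightarrow> ('r cs_vars \<times> (nat \<times> nat \<Rightarrow> real)) set" where
  "linking I = {(c, \<phi>). \<forall>i\<in>players I. payoff c i = (\<Sum>g\<in>groups I. \<phi> (i, g))}"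

end

(* Aggregated and disaggregated points differ only by the linking equations: since the z_{ig} of a
   player sum to 1, the bounds v_{ih} \<le> M z_{ih} for h \<noteq> g add up to the McCormick lower bound for
   v_{ig}. Conversely, if the z_{ig} are binary, the McCormick constraints force \<phi>_{ig} = v_i for
   the group of i and \<phi>_{ig} = 0 for all others, which is linking. The inclusion of the relaxations
   is strict because a player who is spread evenly over two groups may have \<phi>_{ig} = 0 in both of
   them and still be promised the payoff v_i = M / 2. *)
theory Submission
  imports Defs
begin

lemma finite_players [simp]: "finite (players I)"
  by (simp add: players_def)

lemma dis_constraints_imp_agg_constraints:
  assumes "common_constraints I c" and dis: "dis_constraints I c \<phi>"
  shows "agg_constraints I c \<phi>"
proof -
  have "\<phi> (i, g) \<le> payoff c i \<and> payoff c i - bigM I * (1 - member c (i, g)) \<le> \<phi> (i, g)"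
    if i: "i \<in> players I" and g: "g \<in> groups I" for i g
  proof -
    have z: "(\<Sum>h\<in>groups I. member c (i, h)) = 1"
      using assms(1) i by (simp add: common_constraints_def)
    have z': "(\<Sum>h\<in>groups I - {g}. member c (i, h)) = 1 - member c (i, g)"
      using z g by (simp add: sum_diff1)
    have v: "payoff c i = \<phi> (i, g) + (\<Sum>h\<in>groups I - {g}. \<phi> (i, h))"
      using dis i g by (simp add: dis_constraints_def sum_diff1)
    \<comment> \<open>Nonnegativity of the shares in the other groups gives the upper McCormick
      bound \<open>\<phi> (i, g) \<le> payoff c i\<close>.\<close>
    have "0 \<le> (\<Sum>h\<in>groups I - {g}. \<phi> (i, h))"
      using dis i by (intro sum_nonneg) (simp add: dis_constraints_def)
    moreover have "(\<Sum>h\<in>groups I - {g}. \<phi> (i, h)) \<le> (\<Sum>h\<in>groups I - {g}. bigM I * member c (i, h))"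
      using dis i by (intro sum_mono) (simp add: dis_constraints_def)
    then have "(\<Sum>h\<in>groups I - {g}. \<phi> (i, h)) \<le> bigM I * (1 - member c (i, g))"
      by (simp add: z' flip: sum_distrib_left)
    ultimately show ?thesis
      using v by linarith
  qed
  then show ?thesis
    using dis by (simp add: agg_constraints_def dis_constraints_def)
qed

text \<open>The converse only collects constraints: linking supplies the payoff equations, and the
  McCormick system already contains the bounds by 0 and by \<open>bigM I\<close> times membership.
  Every comparison of feasible sets below rests on this equivalence.\<close>

lemma dis_constraints_iff:
  assumes "common_constraints I c"
  shows "dis_constraints I c \<phi> \<longleftrightarrow> agg_constraints I c \<phi> \<and> (c, \<phi>) \<in> linking I"
  using dis_constraints_imp_agg_constraints[OF assms, of \<phi>]
  by (auto simp: dis_constraints_def agg_constraints_def linking_def)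

lemma integral_agg_imp_linking:
  assumes "common_constraints I c" "integral_domain I c" and agg: "agg_constraints I c \<phi>"
  shows "(c, \<phi>) \<in> linking I"
proof -
  have "payoff c i = (\<Sum>g\<in>groups I. \<phi> (i, g))" if i: "i \<in> players I" for i
  proof -
    have z: "(\<Sum>g\<in>groups I. member c (i, g)) = 1"
      using assms(1) i by (simp add: common_constraints_def)
    have bin: "member c (i, g) = 0 \<or> member c (i, g) = 1" if "g \<in> groups I" for g
      using assms(2) i that by (auto simp: integral_domain_def)
    \<comment> \<open>McCormick inequalities linearise this product and are exact at binary
      membership: at 1 the first and third bounds meet in \<open>payoff c i\<close>, at 0 the second
      and fourth meet in 0.\<close>
    have "\<phi> (i, g) = payoff c i * member c (i, g)" if g: "g \<in> groups I" for g
    proof -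
      have "\<phi> (i, g) \<le> payoff c i" "\<phi> (i, g) \<le> bigM I * member c (i, g)"
        "payoff c i - bigM I * (1 - member c (i, g)) \<le> \<phi> (i, g)" "0 \<le> \<phi> (i, g)"
        using agg i g by (auto simp: agg_constraints_def)
      then show ?thesis
        using bin[OF g] by auto
    qed
    then have "(\<Sum>g\<in>groups I. \<phi> (i, g)) = payoff c i * (\<Sum>g\<in>groups I. member c (i, g))"
      by (simp add: sum_distrib_left)
    then show ?thesis
      by (simp add: z)
  qed
  then show ?thesis
    by (simp add: linking_def)
qed

lemma MIP_agg_eq_MIP_disagg: "MIP_agg I = MIP_disagg I"
  using integral_agg_imp_linking
  by (fastforce simp: MIP_agg_def MIP_disagg_def dis_constraints_iff)

lemma F_agg_Int_linking: "F_agg I \<inter> linking I = F_disagg I"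
  by (auto simp: F_agg_def F_disagg_def dis_constraints_iff)

text \<open>The item type is arbitrary, so \<open>undefined\<close> serves as the single item. Its
  unit profit and capacity for player 1 alone make \<open>bigM\<close> equal to 1. The value
  \<open>1 - \<alpha>\<close> is the least admissible \<open>bigM_item\<close>.\<close>

definition gap_instance :: "real \<Rightarrow> 'r cs_instance" where
  "gap_instance \<alpha> =
     \<lparr>num_players = 2, items = {undefined}, avail = (\<lambda>_. {1}), profit = (\<lambda>_ _. 1),
      weight = (\<lambda>_. 1), budget = (\<lambda>_. 0), capacity = (\<lambda>_ _. 1), priv_rows = (\<lambda>_. 0),
      priv_mat = (\<lambda>_ _ _. 0), priv_rhs = (\<lambda>_ _. 0), pooling = \<alpha>, bigM_item = (\<lambda>_. 1 - \<alpha>)\<rparr>"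

text \<open>Player 1 cannot be split, since \<open>z\<close> vanishes at \<open>(1, 2)\<close>; so player 2 has to be.\<close>

definition gap_point :: "real \<Rightarrow> 'r cs_vars" where
  "gap_point \<alpha> =
     \<lparr>payoff = (\<lambda>i\<in>{1, 2}. if i = 2 then 1 / 2 else 0),
      member = (\<lambda>(i, g)\<in>{1, 2} \<times> {1, 2}. if i = 2 then 1 / 2 else if g = 1 then 1 else 0),
      alloc = (\<lambda>_\<in>{(i, g, j). g \<in> {1, 2} \<and> j = undefined \<and> i = 1}. 0),
      quantity = (\<lambda>_\<in>{1, 2} \<times> {undefined}. 0),
      gprofit = (\<lambda>_\<in>{1, 2}. 0),
      pooled = (\<lambda>_\<in>(if \<alpha> < 1 then {1, 2} \<times> {undefined} else {}). 0)\<rparr>"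

definition gap_split :: "nat \<times> nat \<Rightarrow> real" where
  "gap_split = (\<lambda>_\<in>{1, 2} \<times> {1, 2}. 0)"

lemma players_gap_instance: "players (gap_instance \<alpha>) = {1, 2}"
  by (auto simp: players_def gap_instance_def)

lemma valid_gap_instance:
  assumes "0 < \<alpha>" "\<alpha> \<le> 1"
  shows "valid_instance (gap_instance \<alpha>)"
  using assms unfolding valid_instance_def players_gap_instance
  by (simp add: gap_instance_def)

lemma bigM_gap_instance: "bigM (gap_instance \<alpha>) = 1"
  unfolding bigM_def players_gap_instance by (simp add: items_of_def gap_instance_def)

lemma gap_point_in_F_agg:
  assumes "0 < \<alpha>" "\<alpha> \<le> 1"
  shows "(gap_point \<alpha>, gap_split) \<in> F_agg (gap_instance \<alpha>)"
proof -
  have "coordinates (gap_instance \<alpha>) (gap_point \<alpha>) gap_split"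
    unfolding coordinates_def players_gap_instance
    by (auto simp: gap_instance_def gap_point_def gap_split_def)
  \<comment> \<open>Nothing is allocated, so mainly the membership constraints need care: group 2
    has total membership 1 / 2, within the bound 2 * (1 / 2), and group 1 has 3 / 2, within
    2.\<close>
  moreover have "common_constraints (gap_instance \<alpha>) (gap_point \<alpha>)"
    using assms unfolding common_constraints_def pooling_constraints_def players_gap_instance
    by (auto simp: gap_instance_def gap_point_def)
  moreover have "relaxed_domain (gap_instance \<alpha>) (gap_point \<alpha>)"
    unfolding relaxed_domain_def players_gap_instance
    by (auto simp: gap_instance_def gap_point_def)
  \<comment> \<open>For player 2 the McCormick lower bound is tight in both groups: 1 / 2 - 1 * (1 -
    1 / 2) = 0.\<close>
  moreover have "agg_constraints (gap_instance \<alpha>) (gap_point \<alpha>) gap_split"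
    unfolding agg_constraints_def players_gap_instance bigM_gap_instance
    by (auto simp: gap_point_def gap_split_def)
  ultimately show ?thesis
    by (simp add: F_agg_def)
qed

text \<open>The equation of player 2 fails: the payoff is 1 / 2, the shares sum to 0.\<close>

lemma gap_point_not_in_linking: "(gap_point \<alpha>, gap_split) \<notin> linking (gap_instance \<alpha>)"
  unfolding linking_def players_gap_instance by (simp add: gap_point_def gap_split_def)

theorem proposition2:
  shows "(\<forall>I :: 'r cs_instance. valid_instance I \<longrightarrow>
            MIP_agg I = MIP_disagg I \<and>
            F_disagg I \<subseteq> F_agg I \<and>
            F_agg I \<inter> linking I = F_disagg I) \<and>
         (\<forall>\<alpha> :: real. 0 < \<alpha> \<and> \<alpha> \<le> 1 \<longrightarrow>
            (\<exists>I :: 'r cs_instance. valid_instance I \<and> pooling I = \<alpha> \<and> F_disagg I \<subset> F_agg I))"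
proof (intro conjI allI impI)
  fix I :: "'r cs_instance"
  show "MIP_agg I = MIP_disagg I"
    by (rule MIP_agg_eq_MIP_disagg)
  show "F_agg I \<inter> linking I = F_disagg I"
    by (rule F_agg_Int_linking)
  then show "F_disagg I \<subseteq> F_agg I"
    by blast
next
  fix \<alpha> :: real
  assume \<alpha>: "0 < \<alpha> \<and> \<alpha> \<le> 1"
  let ?I = "gap_instance \<alpha> :: 'r cs_instance"
  \<comment> \<open>With \<open>F_disagg\<close> rewritten as the part of \<open>F_agg\<close>
    inside \<open>linking\<close>, one aggregated point outside \<open>linking\<close> gives
    strictness.\<close>
  have "F_disagg ?I \<subset> F_agg ?I"
    using gap_point_in_F_agg[of \<alpha>] gap_point_not_in_linking[of \<alpha>] \<alpha>
    unfolding F_agg_Int_linking[symmetric] by blast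
  moreover have "pooling ?I = \<alpha>"
    by (simp add: gap_instance_def)
  ultimately show "\<exists>I :: 'r cs_instance. valid_instance I \<and> pooling I = \<alpha> \<and> F_disagg I \<subset> F_agg I"
    using valid_gap_instance \<alpha> by blast
qed

end
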